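(* Let $F\in\mathbb R^{d'\times d}$, $b\in\mathbb R^{d'}$ and let $\Sigma\in\mathbb R^{d'\times d'}$ be symmetric positive definite. Let $p(y\mid x)=\mathcal N(y\mid Fx+b,\Sigma)$ be the conditional density on $\mathbb R^{d'}$ given by the Gaussian density with mean $Fx+b$ and covariance $\Sigma$ evaluated at $y$. Then for any $\epsilon>0$ and $R>0$ there exists a Generalized Gaussian PSD model $\hat p$ on $\mathbb R^d\times\mathbb R^{d'}$ of order $1$ such that $$|p(y\mid x)-\hat p(x,y)|\le\epsilon$$ for all $(x,y)\in\mathbb R^d\times\mathbb R^{d'}$ with $\|x\|_2^2+\|y\|_2^2\le R^2$.
   Context: For a positive semidefinite matrix $P\in\mathbb R^{p\times p}$, $k_P(x,y)=e^{-(x-y)^\top P(x-y)}$. A Generalized Gaussian PSD model of order $M$ on $\mathbb R^p$ is a function $f:\mathbb R^p\to\mathbb R$ of the form $f(x)=\mathrm{Tr}(AB(x))$, where $A$ is a positive semidefinite $M\times M$ matrix and, for every $x\in\mathbb R^p$, $B(x)$ is a positive semidefinite $M\times M$ matrix with entries $B(x)_{ij}=e^{C_{ij}}k_{P_{ij}}(x,x_{ij})$ with $C_{ij}\in\mathbb R$, $x_{ij}\in\mathbb R^p$ and $P_{ij}$ a positive semidefinite $p\times p$ matrix. *)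

theory Defs
  imports "HOL-Analysis.Analysis"
begin

text \<open>As usual, (semi)definiteness of a real matrix includes its symmetry.\<close>

definition psd :: "real^'n^'n \<Rightarrow> bool" where
  "psd A \<longleftrightarrow> transpose A = A \<and> (\<forall>v. 0 \<le> v \<bullet> (A *v v))"

definition pos_def :: "real^'n^'n \<Rightarrow> bool" where
  "pos_def A \<longleftrightarrow> transpose A = A \<and> (\<forall>v. v \<noteq> 0 \<longrightarrow> 0 < v \<bullet> (A *v v))"

definition gauss_kernel :: "real^'p^'p \<Rightarrow> real^'p \<Rightarrow> real^'p \<Rightarrow> real" where
  "gauss_kernel P x y = exp (- ((x - y) \<bullet> (P *v (x - y))))"

definition gauss_matrix ::
    "real^'m^'m \<Rightarrow> ('m \<Rightarrow> 'm \<Rightarrow> real^'p) \<Rightarrow> ('m \<Rightarrow> 'm \<Rightarrow> real^'p^'p) \<Rightarrow> real^'p \<Rightarrow> real^'m^'m" where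
  "gauss_matrix C X P x = (\<chi> i j. exp (C $ i $ j) * gauss_kernel (P i j) x (X i j))"

text \<open>The order of the model is the cardinality of the index type of the matrices, which is
  passed as the first argument (so \<open>TYPE(1)\<close> gives the models of order one).\<close>

definition generalized_gaussian_psd_model ::
    "'m::finite itself \<Rightarrow> (real^'p \<Rightarrow> real) \<Rightarrow> bool" where
  "generalized_gaussian_psd_model (_ :: 'm itself) f \<longleftrightarrow>
    (\<exists>(A :: real^'m^'m) C X P.
      psd A \<and> (\<forall>i j. psd (P i j)) \<and> (\<forall>x. psd (gauss_matrix C X P x)) \<and>
      (\<forall>x. f x = trace (A ** gauss_matrix C X P x)))"

text \<open>Density of the normal distribution with mean \<open>\<mu>\<close> and covariance \<open>S\<close>, evaluated at \<open>y\<close>.\<close>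

definition multivariate_normal_density :: "real^'n \<Rightarrow> real^'n^'n \<Rightarrow> real^'n \<Rightarrow> real" where
  "multivariate_normal_density \<mu> S y =
    exp (- (1 / 2) * ((y - \<mu>) \<bullet> (matrix_inv S *v (y - \<mu>)))) / sqrt ((2 * pi) ^ CARD('n) * det S)"

text \<open>A pair of vectors as a single vector of the sum of the dimensions: \<open>real^'a \<times> real^'b\<close> is
  rendered as \<open>real^('a + 'b)\<close>, so that square matrices on the product space are available.\<close>

definition join_vec :: "real^'a \<Rightarrow> real^'b \<Rightarrow> real^('a + 'b)" where
  "join_vec x y = (\<chi> i. case i of Inl a \<Rightarrow> x $ a | Inr b \<Rightarrow> y $ b)"

end

theory Submission
  imports Defs
begin

text \<open>The approximation can be taken exact. With \<open>L (x, y) = y - F x\<close> one has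
  \<open>y - (F x + b) = L ((x, y) - (0, b))\<close>, so the exponent of the conditional density is the
  quadratic form of \<open>P = L\<^sup>T \<Sigma>\<^sup>-\<^sup>1 L / 2\<close> at \<open>(x, y) - (0, b)\<close>, and the normalizing constant goes
  into the \<open>1 \<times> 1\<close> matrix \<open>A\<close>.\<close>

text \<open>Moving \<open>B\<close> across the inner product transposes it. This serves twice:
  congruence preserves semidefiniteness, and the quadratic form of \<open>P\<close> becomes that of
  the inverse covariance at the residual.\<close>

lemma inner_congruence:
  fixes A :: "real^'n^'n" and B :: "real^'m^'n"
  shows "v \<bullet> ((transpose B ** A ** B) *v v) = (B *v v) \<bullet> (A *v (B *v v))"
  using dot_lmul_matrix[of "A *v (B *v v)" B v]
  by (simp add: inner_commute flip: matrix_vector_mul_assoc)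

lemma psd_congruence:
  fixes A :: "real^'n^'n" and B :: "real^'m^'n"
  assumes "psd A"
  shows "psd (transpose B ** A ** B)"
  using assms unfolding psd_def inner_congruence
  by (simp add: matrix_transpose_mul matrix_mul_assoc)

lemma psd_scaleR: "0 \<le> c \<Longrightarrow> psd A \<Longrightarrow> psd (c *\<^sub>R A)"
  by (simp add: psd_def transpose_scalar scalar_matrix_assoc scaleR_matrix_vector_assoc[symmetric])

lemma pos_def_imp_psd: "pos_def A \<Longrightarrow> psd A"
  unfolding pos_def_def psd_def
  by (metis inner_zero_left order.refl order.strict_implies_order)

lemma pos_def_imp_invertible:
  fixes A :: "real^'n^'n"
  assumes "pos_def A"
  shows "invertible A"
proof -
  have "v = 0" if "A *v v = 0" for v
    using assms that unfolding pos_def_def by force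
  then show ?thesis
    by (simp add: invertible_left_inverse matrix_left_invertible_ker)
qed

text \<open>With J the inverse of \<open>A\<close>, the congruence J^T A J collapses to J^T. So J^T
  is semidefinite, hence symmetric, hence equal to J.\<close>

lemma psd_matrix_inv:
  fixes A :: "real^'n^'n"
  assumes "pos_def A"
  shows "psd (matrix_inv A)"
proof -
  have "A ** matrix_inv A = mat 1"
    using pos_def_imp_invertible[OF assms] someI_ex[of "\<lambda>B. A ** B = mat 1 \<and> B ** A = mat 1"]
    by (simp add: invertible_def matrix_inv_def)
  then have "transpose (matrix_inv A) ** A ** matrix_inv A = transpose (matrix_inv A)"
    by (simp flip: matrix_mul_assoc)
  then have "psd (transpose (matrix_inv A))"
    using psd_congruence[OF pos_def_imp_psd[OF assms], of "matrix_inv A"] by simp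
  then show ?thesis
    unfolding psd_def by (metis transpose_transpose)
qed

lemma pos_def_segment_mat_1:
  fixes A :: "real^'n^'n"
  assumes "pos_def A" "0 \<le> t" "t \<le> 1"
  shows "pos_def ((1 - t) *\<^sub>R mat 1 + t *\<^sub>R A)"
proof -
  have "0 < v \<bullet> (((1 - t) *\<^sub>R mat 1 + t *\<^sub>R A) *v v)" if "v \<noteq> 0" for v
  proof -
    have "v \<bullet> (((1 - t) *\<^sub>R mat 1 + t *\<^sub>R A) *v v) = (1 - t) * (v \<bullet> v) + t * (v \<bullet> (A *v v))"
      by (simp add: matrix_vector_mult_add_rdistrib scaleR_matrix_vector_assoc[symmetric]
          inner_add_right)
    moreover have "0 < v \<bullet> v" "0 < v \<bullet> (A *v v)"
      using assms(1) that by (auto simp: pos_def_def)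
    ultimately show ?thesis
      \<comment> \<open>For t > 0 the second summand is strictly positive, while the first may
        vanish at t = 1; for t = 0 only v . v remains.\<close>
      using assms(2,3) by (cases "t = 0") (auto intro!: add_nonneg_pos)
  qed
  moreover have "transpose ((1 - t) *\<^sub>R mat 1 + t *\<^sub>R A) = (1 - t) *\<^sub>R mat 1 + t *\<^sub>R A"
    using assms(1) by (auto simp: pos_def_def transpose_def mat_def vec_eq_iff)
  ultimately show ?thesis
    by (simp add: pos_def_def)
qed

text \<open>The determinant does not vanish on the segment from the identity matrix to \<open>A\<close>, so it keeps
  its sign there.\<close>

lemma det_pos_def:
  fixes A :: "real^'n^'n"
  assumes "pos_def A"
  shows "0 < det A"
proof (rule ccontr)
  define h where "h t = det ((1 - t) *\<^sub>R mat 1 + t *\<^sub>R A)" for t :: real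
  assume "\<not> 0 < det A"
  \<comment> \<open>The endpoint values are \<open>h 1 = det A\<close> and \<open>h 0 = 1\<close>,
    the determinant of the identity.\<close>
  then have "h 1 \<le> 0" "0 \<le> h 0"
    by (simp_all add: h_def)
  moreover have "continuous_on {0..1} h"
    unfolding h_def det_def by (intro continuous_intros)
  ultimately obtain t where "0 \<le> t" "t \<le> 1" "h t = 0"
    using IVT2'[of h 1 0 0] by auto
  then show False
    using pos_def_imp_invertible[OF pos_def_segment_mat_1[OF assms]]
    by (auto simp: h_def invertible_det_nz)
qed

lemma psd_order_one: "psd (B :: real^1^1) \<longleftrightarrow> 0 \<le> B $ 1 $ 1"
proof -
  have "v \<bullet> (B *v v) = B $ 1 $ 1 * (v $ 1)\<^sup>2" for v
    by (simp add: inner_vec_def matrix_vector_mult_def sum_1 power2_eq_square)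
  moreover have "0 \<le> B $ 1 $ 1" if "\<forall>v. 0 \<le> B $ 1 $ 1 * ((v :: real^1) $ 1)\<^sup>2"
    \<comment> \<open>At the vector with entry 1 the form equals the single entry of
      \<open>B\<close>.\<close>
    using spec[OF that, of "vec 1"] by simp
  ultimately show ?thesis
    by (auto simp: psd_def transpose_def vec_eq_iff forall_1)
qed

text \<open>The factor \<open>c\<close> is the entry of the weight matrix and the exponent matrix is
  0, so the kernel matrix has a single positive entry at every point.\<close>

lemma generalized_gaussian_psd_model_order_one:
  assumes "0 \<le> c" "psd P"
  shows "generalized_gaussian_psd_model TYPE(1) (\<lambda>z. c * gauss_kernel P z z0)"
  unfolding generalized_gaussian_psd_model_def
proof (intro exI conjI allI)
  show "psd (mat c :: real^1^1)"
    using assms(1) by (simp add: psd_order_one mat_def)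
  show "psd P" by fact
  show "psd (gauss_matrix 0 (\<lambda>_ _. z0) (\<lambda>_ _. P) z :: real^1^1)" for z
    by (simp add: psd_order_one gauss_matrix_def gauss_kernel_def)
  show "c * gauss_kernel P z z0
      = trace (mat c ** (gauss_matrix 0 (\<lambda>_ _. z0) (\<lambda>_ _. P) z :: real^1^1))" for z
    by (simp add: trace_def matrix_matrix_mult_def mat_def gauss_matrix_def sum_1)
qed

text \<open>The block row [-F, I], which is the map \<open>L\<close> of the overview.\<close>

definition residual_matrix :: "real^'d^'e \<Rightarrow> real^('d + 'e)^'e" where
  "residual_matrix F = (\<chi> i j. case j of Inl a \<Rightarrow> - F $ i $ a | Inr c \<Rightarrow> mat 1 $ i $ c)"

lemma residual_matrix_join_vec:
  fixes F :: "real^'d^'e"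
  shows "residual_matrix F *v join_vec x y = y - F *v x"
proof -
  \<comment> \<open>Contribution of the identity block; the sum over the sum type then splits into
    this and the block of -F.\<close>
  have "(\<Sum>c\<in>UNIV. mat 1 $ i $ c * y $ c) = y $ i" for i
    using matrix_vector_mul_lid[of y] by (simp add: matrix_vector_mult_def vec_eq_iff)
  then show ?thesis
    by (simp add: vec_eq_iff matrix_vector_mult_def residual_matrix_def join_vec_def
        UNIV_Plus_UNIV[symmetric] sum.Plus sum_negf del: UNIV_Plus_UNIV)
qed

lemma conditional_density_eq_gauss_kernel:
  fixes F :: "real^'d^'e" and b :: "real^'e"
  defines "L \<equiv> residual_matrix F"
  shows "multivariate_normal_density (F *v x + b) S y =
    1 / sqrt ((2 * pi) ^ CARD('e) * det S) *
    gauss_kernel ((1 / 2) *\<^sub>R (transpose L ** matrix_inv S ** L)) (join_vec x y) (join_vec 0 b)"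
proof -
  \<comment> \<open>Since F 0 = 0, \<open>L\<close> maps the centre (0, b) to b. The 1/2 of the
    Gaussian exponent is absorbed into the kernel matrix.\<close>
  have "L *v (join_vec x y - join_vec 0 b) = y - (F *v x + b)"
    by (simp add: L_def matrix_vector_mult_diff_distrib residual_matrix_join_vec)
  then show ?thesis
    by (simp add: multivariate_normal_density_def gauss_kernel_def inner_congruence
        scaleR_matrix_vector_assoc[symmetric])
qed

theorem theorem3:
  fixes F :: "real^'d^'e" and b :: "real^'e" and \<Sigma> :: "real^'e^'e"
    and \<epsilon> R :: real
  assumes "pos_def \<Sigma>"
    and "\<epsilon> > 0" and "R > 0"
  shows "\<exists>p_hat :: real^('d + 'e) \<Rightarrow> real.
    generalized_gaussian_psd_model TYPE(1) p_hat \<and>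
    (\<forall>(x :: real^'d) (y :: real^'e). (norm x)\<^sup>2 + (norm y)\<^sup>2 \<le> R\<^sup>2 \<longrightarrow>
      \<bar>multivariate_normal_density (F *v x + b) \<Sigma> y - p_hat (join_vec x y)\<bar> \<le> \<epsilon>)"
proof -
  define L where "L = residual_matrix F"
  define P where "P = (1 / 2) *\<^sub>R (transpose L ** matrix_inv \<Sigma> ** L)"
  define c where "c = 1 / sqrt ((2 * pi) ^ CARD('e) * det \<Sigma>)"
  have "psd P"
    unfolding P_def by (intro psd_scaleR psd_congruence psd_matrix_inv assms) simp
  moreover have "0 \<le> c"
    \<comment> \<open>The sign of \<open>sqrt\<close> follows that of its argument, so the positive
      determinant is what makes \<open>c\<close> nonnegative.\<close>
    using det_pos_def[OF assms(1)] by (simp add: c_def)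
  ultimately have "generalized_gaussian_psd_model TYPE(1) (\<lambda>z. c * gauss_kernel P z (join_vec 0 b))"
    by (intro generalized_gaussian_psd_model_order_one)
  moreover have "multivariate_normal_density (F *v x + b) \<Sigma> y
      = c * gauss_kernel P (join_vec x y) (join_vec 0 b)" for x y
    unfolding c_def P_def L_def by (rule conditional_density_eq_gauss_kernel)
  ultimately show ?thesis
    \<comment> \<open>The model equals the density, so the error is 0.\<close>
    using assms(2) by (intro exI[of _ "\<lambda>z. c * gauss_kernel P z (join_vec 0 b)"]) simp
qed

end
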